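(* Let $X=W/\langle f\rangle$ be a generic Hopf manifold of dimension $n\ge 3$. Then every (possibly singular) one-dimensional holomorphic foliation on $X$ is induced by a monomial vector field.
   Context: Let $W=\mathbb C^n\setminus\{0\}$ and $f(z_1,\dots,z_n)=(\mu_1z_1,\dots,\mu_nz_n)$ with $0<|\mu_i|<1$ for all $i$. The compact complex manifold $X=W/\langle f\rangle$ is called a Hopf manifold. Here $\mathbb N$ includes $0$. $X$ is generic if $0<|\mu_1|\le\dots\le|\mu_n|<1$ and there is no non-trivial relation $\prod_{i\in A}\mu_i^{r_i}=\prod_{j\in B}\mu_j^{r_j}$ with $r_i,r_j\in\mathbb N$, $A\cap B=\emptyset$, $A\cup B=\{1,\dots,n\}$ (non-trivial: not all exponents are zero). For $b\in\mathbb C^*$, $L_b$ is the line bundle on $X$ obtained as the quotient of $W\times\mathbb C$ by $(z,v)\mapsto(f(z),bv)$; every line bundle on $X$ is of this form, and $TX\cong L_{\mu_1}\oplus\dots\oplus L_{\mu_n}$, the $i$-th summand being generated on $W$ by $\partial/\partial z_i$. A (possibly singular) one-dimensional holomorphic foliation on $X$ is given by a nonzero morphism $L_b\to TX$ for some $b\in\mathbb C^*$, i.e. a nonzero section of $TX\otimes L_{b^{-1}}$. Pulling it back to $W$ gives a nonzero holomorphic vector field $v=\sum g_k\,\partial/\partial z_k$ on $W$ with $g_k(f(z))=\mu_kb^{-1}g_k(z)$; one says that the foliation is induced by $v$. A monomial vector field is one for which each coefficient $g_k$ is a complex constant times a monomial in $z_1,\dots,z_n$. *)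

theory Defs
  imports "HOL-Analysis.Analysis"
begin

(* For a bijection h: p and q are related iff they lie in the same orbit of the cyclic group
   generated by h, i.e. q = h^m(p) for an integer m. *)
definition orbit_rel :: "('a \<Rightarrow> 'a) \<Rightarrow> 'a rel" where
  "orbit_rel h = {(p, q). \<exists>m::nat. q = (h ^^ m) p \<or> p = (h ^^ m) q}"

lemma equiv_orbit_rel:
  assumes "inj h"
  shows "equiv UNIV (orbit_rel h)"
proof (rule equivI)
  show "refl (orbit_rel h)"
    by (auto simp: refl_on_def orbit_rel_def intro: exI[of _ 0])
  show "sym (orbit_rel h)"
    by (auto simp: sym_def orbit_rel_def)
  have inj: "inj (h ^^ m)" for m
    using assms by (induction m) (auto simp: inj_compose)
  have cancel: "(x, z) \<in> orbit_rel h" if "(h ^^ m) x = (h ^^ k) z" for x z m k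
  proof (cases "m \<le> k")
    case True
    then have "(h ^^ m) x = (h ^^ m) ((h ^^ (k - m)) z)"
      using that by (metis comp_apply funpow_add le_add_diff_inverse)
    then show ?thesis using inj[of m] by (auto simp: orbit_rel_def dest: injD)
  next
    case False
    then have "(h ^^ k) z = (h ^^ k) ((h ^^ (m - k)) x)"
      using that by (metis comp_apply funpow_add le_add_diff_inverse nat_le_linear)
    then show ?thesis using inj[of k] by (auto simp: orbit_rel_def dest: injD)
  qed
  show "trans (orbit_rel h)"
  proof (rule transI)
    fix x y z assume "(x, y) \<in> orbit_rel h" "(y, z) \<in> orbit_rel h"
    then obtain a b c d where "(h ^^ a) x = (h ^^ b) y" "(h ^^ c) y = (h ^^ d) z"
      unfolding orbit_rel_def by (auto, (metis funpow_0)+)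
    then have "(h ^^ (c + a)) x = (h ^^ (b + d)) z"
      by (metis add.commute comp_apply funpow_add)
    then show "(x, z) \<in> orbit_rel h" by (rule cancel)
  qed
qed simp

definition hopf_cover :: "(complex ^ 'n) set" where
  "hopf_cover = UNIV - {0}"

definition hopf_map :: "complex ^ 'n \<Rightarrow> complex ^ 'n \<Rightarrow> complex ^ 'n" where
  "hopf_map \<mu> z = (\<chi> i. \<mu> $ i * z $ i)"

definition hopf_manifold :: "complex ^ 'n \<Rightarrow> (complex ^ 'n) set set" where
  "hopf_manifold \<mu> = hopf_cover // orbit_rel (hopf_map \<mu>)"

definition generic_hopf :: "complex ^ 'n::{finite,linorder} \<Rightarrow> bool" where
  "generic_hopf \<mu> \<longleftrightarrow>
     (\<forall>i. 0 < norm (\<mu> $ i) \<and> norm (\<mu> $ i) < 1) \<and>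
     (\<forall>i j. i \<le> j \<longrightarrow> norm (\<mu> $ i) \<le> norm (\<mu> $ j)) \<and>
     \<not> (\<exists>A B (r :: 'n \<Rightarrow> nat). A \<inter> B = {} \<and> A \<union> B = UNIV \<and> (\<exists>i. r i \<noteq> 0) \<and>
           (\<Prod>i\<in>A. (\<mu> $ i) ^ r i) = (\<Prod>j\<in>B. (\<mu> $ j) ^ r j))"

definition line_act ::
  "complex ^ 'n \<Rightarrow> complex \<Rightarrow> (complex ^ 'n) \<times> complex \<Rightarrow> (complex ^ 'n) \<times> complex" where
  "line_act \<mu> b = (\<lambda>(z, t). (hopf_map \<mu> z, b * t))"

definition line_bundle ::
  "complex ^ 'n \<Rightarrow> complex \<Rightarrow> ((complex ^ 'n) \<times> complex) set set" where
  "line_bundle \<mu> b = (hopf_cover \<times> UNIV) // orbit_rel (line_act \<mu> b)"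

abbreviation line_class ::
  "complex ^ 'n \<Rightarrow> complex \<Rightarrow> complex ^ 'n \<Rightarrow> complex \<Rightarrow> ((complex ^ 'n) \<times> complex) set" where
  "line_class \<mu> b z t \<equiv> orbit_rel (line_act \<mu> b) `` {(z, t)}"

(* The tangent bundle of the quotient is the quotient of the tangent bundle of the cover
   by the differential of the deck transformation. *)
definition tangent_act ::
  "complex ^ 'n \<Rightarrow> (complex ^ 'n) \<times> (complex ^ 'n) \<Rightarrow> (complex ^ 'n) \<times> (complex ^ 'n)" where
  "tangent_act \<mu> = (\<lambda>(z, w). (hopf_map \<mu> z, frechet_derivative (hopf_map \<mu>) (at z) w))"

definition tangent_bundle :: "complex ^ 'n \<Rightarrow> ((complex ^ 'n) \<times> (complex ^ 'n)) set set" where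
  "tangent_bundle \<mu> = (hopf_cover \<times> UNIV) // orbit_rel (tangent_act \<mu>)"

abbreviation tangent_class ::
  "complex ^ 'n \<Rightarrow> complex ^ 'n \<Rightarrow> complex ^ 'n \<Rightarrow> ((complex ^ 'n) \<times> (complex ^ 'n)) set" where
  "tangent_class \<mu> z w \<equiv> orbit_rel (tangent_act \<mu>) `` {(z, w)}"

lemma frechet_derivative_hopf_map: "frechet_derivative (hopf_map \<mu>) (at z) = hopf_map \<mu>"
proof -
  have "linear (hopf_map \<mu>)"
    by (rule linearI) (auto simp: hopf_map_def vec_eq_iff algebra_simps)
  then show ?thesis
    by (metis frechet_derivative_at linear_conv_bounded_linear bounded_linear_imp_has_derivative)
qed

(* Complex differentiability of a map between complex vector spaces, whose complex structures
   (multiplication by the imaginary unit) are I and J: the real derivative is complex-linear. *)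
definition holo_wrt :: "('a::real_normed_vector \<Rightarrow> 'a) \<Rightarrow> ('b::real_normed_vector \<Rightarrow> 'b) \<Rightarrow>
    ('a \<Rightarrow> 'b) \<Rightarrow> 'a set \<Rightarrow> bool" where
  "holo_wrt I J g S \<longleftrightarrow>
     (\<forall>p\<in>S. \<exists>D. (g has_derivative D) (at p) \<and> (\<forall>w. D (I w) = J (D w)))"

(* The total spaces carry the complex structure making the quotient maps from the covers
   local biholomorphisms, so a map between them is holomorphic iff near every point of the
   cover it lifts to a holomorphic map between the covers. *)
definition holomorphic_bundle_map ::
  "complex ^ 'n \<Rightarrow> complex \<Rightarrow>
   (((complex ^ 'n) \<times> complex) set \<Rightarrow> ((complex ^ 'n) \<times> (complex ^ 'n)) set) \<Rightarrow> bool" where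
  "holomorphic_bundle_map \<mu> b F \<longleftrightarrow>
     (\<forall>p \<in> hopf_cover \<times> UNIV. \<exists>U G. open U \<and> p \<in> U \<and> U \<subseteq> hopf_cover \<times> UNIV \<and>
        G ` U \<subseteq> hopf_cover \<times> UNIV \<and>
        holo_wrt (map_prod ((*s) \<i>) ((*) \<i>)) (map_prod ((*s) \<i>) ((*s) \<i>)) G U \<and>
        (\<forall>q\<in>U. F (orbit_rel (line_act \<mu> b) `` {q}) = orbit_rel (tangent_act \<mu>) `` {G q}))"

(* For a representative z of the point x of the Hopf manifold, t \<mapsto> [(z, t)] and w \<mapsto> [(z, w)]
   are the linear identifications of the model fibres with the fibres over x; hence the second
   clause says that F covers the identity and is complex-linear on fibres. *)
definition bundle_morphism ::
  "complex ^ 'n \<Rightarrow> complex \<Rightarrow>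
   (((complex ^ 'n) \<times> complex) set \<Rightarrow> ((complex ^ 'n) \<times> (complex ^ 'n)) set) \<Rightarrow> bool" where
  "bundle_morphism \<mu> b F \<longleftrightarrow>
     F \<in> line_bundle \<mu> b \<rightarrow> tangent_bundle \<mu> \<and>
     (\<forall>x \<in> hopf_manifold \<mu>. \<forall>z \<in> x. \<exists>l. Vector_Spaces.linear (*) (*s) l \<and>
        (\<forall>t. F (line_class \<mu> b z t) = tangent_class \<mu> z (l t))) \<and>
     holomorphic_bundle_map \<mu> b F"

definition foliation ::
  "complex ^ 'n \<Rightarrow> complex \<Rightarrow>
   (((complex ^ 'n) \<times> complex) set \<Rightarrow> ((complex ^ 'n) \<times> (complex ^ 'n)) set) \<Rightarrow> bool" where
  "foliation \<mu> b F \<longleftrightarrow> bundle_morphism \<mu> b F \<and>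
     (\<exists>z \<in> hopf_cover. \<exists>t. F (line_class \<mu> b z t) \<noteq> tangent_class \<mu> z 0)"

(* v is the pull-back of F to the cover, where the line bundle has the generating
   section z \<mapsto> (z, 1). *)
definition induced_by ::
  "complex ^ 'n \<Rightarrow> complex \<Rightarrow>
   (((complex ^ 'n) \<times> complex) set \<Rightarrow> ((complex ^ 'n) \<times> (complex ^ 'n)) set) \<Rightarrow>
   (complex ^ 'n \<Rightarrow> complex ^ 'n) \<Rightarrow> bool" where
  "induced_by \<mu> b F v \<longleftrightarrow>
     (\<forall>z \<in> hopf_cover. \<forall>t. F (line_class \<mu> b z t) = tangent_class \<mu> z (t *s v z))"

definition monomial_vector_field :: "(complex ^ 'n \<Rightarrow> complex ^ 'n) \<Rightarrow> bool" where
  "monomial_vector_field v \<longleftrightarrow>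
     (\<forall>k. \<exists>(c::complex) (a :: 'n \<Rightarrow> nat). \<forall>z \<in> hopf_cover.
        v z $ k = c * (\<Prod>i\<in>UNIV. (z $ i) ^ a i))"

end

theory Submission
  imports Defs "HOL-Complex_Analysis.Cauchy_Integral_Formula"
begin

text \<open>
  A morphism from the line bundle to the tangent bundle pulls back to a holomorphic vector field
  \<open>g\<close> on the cover whose components satisfy \<open>g (hopf_map \<mu> z) $ k = \<mu> $ k / b * g z $ k\<close>
  (\<open>bundle_morphism_lift\<close>, \<open>induced_by_holomorphic\<close>, \<open>induced_by_equivariant\<close>). Here the only
  subtlety is that a local lift of the morphism is determined only up to a deck transformation.

  It remains to see that a holomorphic function \<open>h\<close> on the punctured space with
  \<open>h (hopf_map \<mu> z) = \<kappa> * h z\<close> and \<open>\<kappa> \<noteq> 0\<close> is a multiple of one monomial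
  (\<open>eigenfunction_monomial\<close>). The classical argument extends \<open>h\<close> over the origin by Hartogs and compares
  coefficients in the power series: the coefficient at the exponent \<open>a\<close> vanishes unless the weight
  \<open>\<Prod>i. \<mu> $ i ^ a i\<close> equals \<open>\<kappa>\<close>, and genericity says that at most one exponent has that weight.
  The proof below keeps the comparison of weights but replaces the extension and the power series by
  one-variable arguments. Since \<open>hopf_map \<mu>\<close> is a contraction, the functional equation forces
  polynomial growth at infinity (\<open>eigen_growth\<close>). A coordinate line through a point with non-zero coordinates
  does not meet the origin, so Liouville's theorem shows that \<open>h\<close> is a polynomial of bounded degree
  in each variable separately. Eliminating one variable at a time then produces the monomial
  (\<open>separately_polynomial_eigenfunction_monomial\<close>), first where all coordinates are non-zero and
  by continuity on the whole punctured space.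
\<close>

section \<open>Separately polynomial eigenfunctions on the torus\<close>

text \<open>
  The discrete Fourier coefficient of \<open>\<phi>\<close> over the roots of unity of order \<open>Suc N\<close>.
  It recovers the coefficient of \<open>\<zeta> ^ k\<close> in a polynomial of degree at most \<open>N\<close> linearly from finitely
  many non-zero sample points. Linearity is what lets a coefficient inherit the properties of \<open>\<phi>\<close> in
  all other variables, and avoiding the sample point 0 keeps every evaluation inside the torus
  of points with non-zero coordinates. The exponent \<open>Suc N - k\<close> stands for \<open>- k\<close>.
\<close>
definition dft_coeff :: "nat \<Rightarrow> nat \<Rightarrow> (complex \<Rightarrow> complex) \<Rightarrow> complex" where
  "dft_coeff N k \<phi> =
     (\<Sum>j<Suc N. (exp (2 * of_real pi * \<i> * of_nat j / of_nat (Suc N))) ^ (Suc N - k) *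
        \<phi> (exp (2 * of_real pi * \<i> * of_nat j / of_nat (Suc N)))) / of_nat (Suc N)"

lemma dft_coeff_eq:
  assumes "k \<le> N" and \<phi>: "\<And>\<zeta>. \<zeta> \<noteq> 0 \<Longrightarrow> \<phi> \<zeta> = (\<Sum>l\<le>N. c l * \<zeta> ^ l)"
  shows "dft_coeff N k \<phi> = c k"
proof -
  define M where "M = Suc N"
  define \<omega> where "\<omega> j = exp (2 * of_real pi * \<i> * of_nat j / of_nat M)" for j
  have \<omega>_power: "\<omega> j ^ m = \<omega> m ^ j" for j m
    by (simp add: \<omega>_def exp_of_nat_mult [symmetric] algebra_simps)
  have orth: "(\<Sum>j<M. \<omega> j ^ (M - k + l)) = (if l = k then of_nat M else 0)" if "l \<le> N" for l
  proof (cases "l = k")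
    case True
    have "\<omega> j ^ M = 1" for j
      using complex_root_unity [of M j] by (simp add: \<omega>_def M_def)
    then show ?thesis using True assms by (simp add: M_def)
  next
    case False
    have "\<not> M dvd M - k + l"
    proof
      assume "M dvd M - k + l"
      then obtain q where q: "M - k + l = M * q" by blast
      have "M * 2 \<le> M * q" if "2 \<le> q"
        using that by (rule mult_le_mono2)
      moreover have "q \<noteq> 0"
        using q assms(1) by (intro notI) (simp add: M_def)
      moreover have "q \<noteq> 1"
        using q assms(1) False by (intro notI) (simp add: M_def)
      ultimately show False
        using q that assms(1) by (cases "2 \<le> q") (simp_all add: M_def)
    qed
    then have "\<omega> (M - k + l) \<noteq> 1"
      using complex_root_unity_eq_1 [of M "M - k + l"] by (simp add: \<omega>_def M_def)
    moreover have "\<omega> (M - k + l) ^ M = 1"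
      using complex_root_unity [of M "M - k + l"] by (simp add: \<omega>_def M_def)
    ultimately show ?thesis
      using False geometric_sum [of "\<omega> (M - k + l)" M] by (simp add: \<omega>_power)
  qed
  have "(\<Sum>j<M. \<omega> j ^ (M - k) * \<phi> (\<omega> j))
      = (\<Sum>j<M. \<Sum>l\<le>N. c l * \<omega> j ^ (M - k + l))"
    by (simp add: \<phi> \<omega>_def sum_distrib_left power_add algebra_simps)
  also have "\<dots> = (\<Sum>l\<le>N. c l * (\<Sum>j<M. \<omega> j ^ (M - k + l)))"
    by (subst sum.swap) (simp add: sum_distrib_left)
  also have "\<dots> = (\<Sum>l\<le>N. if l = k then c l * of_nat M else 0)"
    by (intro sum.cong) (simp_all add: orth)
  also have "\<dots> = c k * of_nat M"
    using assms(1) by simp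
  finally show ?thesis
    unfolding dft_coeff_def M_def [symmetric] \<omega>_def [symmetric]
    using nonzero_mult_div_cancel_right [of "of_nat M" "c k"] by (simp only: M_def of_nat_eq_0_iff nat.distinct not_False_eq_True)
qed

lemma dft_coeff_cong:
  assumes "\<And>\<zeta>. \<zeta> \<noteq> 0 \<Longrightarrow> \<phi> \<zeta> = \<psi> \<zeta>"
  shows "dft_coeff N k \<phi> = dft_coeff N k \<psi>"
  using assms by (simp add: dft_coeff_def)

lemma dft_coeff_sum:
  "dft_coeff N k (\<lambda>\<zeta>. \<Sum>m\<in>I. \<phi> m \<zeta> * a m) = (\<Sum>m\<in>I. dft_coeff N k (\<phi> m) * a m)"
  unfolding dft_coeff_def sum_distrib_left sum_distrib_right sum_divide_distrib
  by (rule trans [OF sum.swap]) (simp add: mult_ac)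

text \<open>
  Induction on the set \<open>S\<close> of variables that \<open>q\<close> depends on. Expanding \<open>q\<close> in powers of
  one variable \<open>x i\<close> gives coefficient functions \<open>C k\<close> of the remaining variables. They are again
  separately polynomial, and comparing coefficients in the eigenvalue equation makes \<open>C k\<close> an
  eigenfunction for \<open>\<kappa> / \<mu> i ^ k\<close>; this is why \<open>\<kappa>\<close> must vary in the induction. So each \<open>C k\<close> is
  a monomial, and \<open>q\<close> is a sum of at most \<open>N + 1\<close> monomials. Each one that occurs has weight \<open>\<kappa>\<close>,
  and distinct exponents have distinct weights by \<open>gen\<close>, so all of them have the same exponent.
\<close>
lemma separately_polynomial_eigenfunction_monomial:
  fixes q :: "('n::finite \<Rightarrow> complex) \<Rightarrow> complex" and \<mu> :: "'n \<Rightarrow> complex"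
  assumes "finite S"
    and \<mu>0: "\<And>i. \<mu> i \<noteq> 0"
    and gen: "\<And>a b :: 'n \<Rightarrow> nat. (\<Prod>i\<in>UNIV. \<mu> i ^ a i) = (\<Prod>i\<in>UNIV. \<mu> i ^ b i) \<Longrightarrow> a = b"
    and dep: "\<And>x y. (\<And>i. i \<in> S \<Longrightarrow> x i = y i) \<Longrightarrow> q x = q y"
    and sep: "\<And>i x. i \<in> S \<Longrightarrow> (\<And>l. x l \<noteq> 0) \<Longrightarrow>
                \<exists>c. \<forall>\<zeta>. \<zeta> \<noteq> 0 \<longrightarrow> q (x(i := \<zeta>)) = (\<Sum>k\<le>N. c k * \<zeta> ^ k)"
    and eigen: "\<And>x. (\<And>l. x l \<noteq> 0) \<Longrightarrow> q (\<lambda>i. \<mu> i * x i) = \<kappa> * q x"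
  shows "\<exists>c a. \<forall>x. (\<forall>l. x l \<noteq> 0) \<longrightarrow> q x = c * (\<Prod>i\<in>UNIV. x i ^ a i)"
  using assms(1) dep sep eigen
proof (induction S arbitrary: q \<kappa> rule: finite_induct)
  case empty
  then have "q x = q (\<lambda>_. 1) * (\<Prod>i\<in>UNIV. x i ^ 0)" for x
    by simp
  then show ?case by (intro exI[of _ "q (\<lambda>_. 1)"] exI[of _ "\<lambda>_. 0"]) blast
next
  case (insert i S)
  note dep = insert.prems(1) and sep = insert.prems(2) and eigen = insert.prems(3)
  \<comment> \<open>Since x i is overwritten, C k depends only on the variables in S.\<close>
  define C where "C k x = dft_coeff N k (\<lambda>\<zeta>. q (x(i := \<zeta>)))" for k x
  have expand: "q (x(i := \<zeta>)) = (\<Sum>k\<le>N. C k x * \<zeta> ^ k)"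
    if x: "\<And>l. x l \<noteq> 0" and "\<zeta> \<noteq> 0" for x \<zeta>
  proof -
    obtain c where c: "\<And>\<zeta>. \<zeta> \<noteq> 0 \<Longrightarrow> q (x(i := \<zeta>)) = (\<Sum>k\<le>N. c k * \<zeta> ^ k)"
      using sep [of i x] x by blast
    have "C k x = c k" if "k \<le> N" for k
      unfolding C_def by (rule dft_coeff_eq [OF that c])
    then show ?thesis using c [OF \<open>\<zeta> \<noteq> 0\<close>] by simp
  qed
  have C_eigen: "C k (\<lambda>l. \<mu> l * x l) = \<kappa> / \<mu> i ^ k * C k x"
    if x: "\<And>l. x l \<noteq> 0" and k: "k \<le> N" for x k
  proof -
    have "q ((\<lambda>l. \<mu> l * x l)(i := \<zeta>)) = (\<Sum>k\<le>N. \<kappa> / \<mu> i ^ k * C k x * \<zeta> ^ k)"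
      if "\<zeta> \<noteq> 0" for \<zeta>
    proof -
      have eq: "(\<lambda>l. \<mu> l * x l)(i := \<zeta>) = (\<lambda>l. \<mu> l * (x(i := \<zeta> / \<mu> i)) l)"
        using \<mu>0 by auto
      have nz: "(x(i := \<zeta> / \<mu> i)) l \<noteq> 0" for l
        using x \<mu>0 that by simp
      have "q ((\<lambda>l. \<mu> l * x l)(i := \<zeta>)) = \<kappa> * q (x(i := \<zeta> / \<mu> i))"
        unfolding eq by (rule eigen [OF nz])
      also have "\<dots> = \<kappa> * (\<Sum>k\<le>N. C k x * (\<zeta> / \<mu> i) ^ k)"
        using expand [of x "\<zeta> / \<mu> i"] x \<mu>0 that by simp
      finally show ?thesis
        by (simp add: sum_distrib_left power_divide algebra_simps)
    qed
    then show ?thesis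
      unfolding C_def [of k "\<lambda>l. \<mu> l * x l"] by (rule dft_coeff_eq [OF k])
  qed
  have "\<exists>c a. \<forall>x. (\<forall>l. x l \<noteq> 0) \<longrightarrow> C k x = c * (\<Prod>l\<in>UNIV. x l ^ a l)" if k: "k \<le> N" for k
  proof (rule insert.IH)
    show "C k x = C k y" if "\<And>l. l \<in> S \<Longrightarrow> x l = y l" for x y
      unfolding C_def by (intro dft_coeff_cong dep) (use that in auto)
    show "C k (\<lambda>l. \<mu> l * x l) = \<kappa> / \<mu> i ^ k * C k x" if "\<And>l. x l \<noteq> 0" for x
      by (rule C_eigen [OF that k])
    show "\<exists>c. \<forall>\<zeta>. \<zeta> \<noteq> 0 \<longrightarrow> C k (x(l := \<zeta>)) = (\<Sum>m\<le>N. c m * \<zeta> ^ m)"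
      if l: "l \<in> S" and x: "\<And>l. x l \<noteq> 0" for l x
    proof -
      have "l \<noteq> i" using l insert.hyps by auto
      have "\<exists>c. \<forall>\<zeta>. \<zeta> \<noteq> 0 \<longrightarrow> q (x(i := \<eta>, l := \<zeta>)) = (\<Sum>m\<le>N. c m * \<zeta> ^ m)"
        if "\<eta> \<noteq> 0" for \<eta>
      proof -
        have "(x(i := \<eta>)) l' \<noteq> 0" for l'
          using x that by simp
        then show ?thesis by (rule sep [OF insertI2 [OF l]])
      qed
      then obtain d where d: "\<And>\<eta> \<zeta>. \<eta> \<noteq> 0 \<Longrightarrow> \<zeta> \<noteq> 0 \<Longrightarrow>
          q (x(i := \<eta>, l := \<zeta>)) = (\<Sum>m\<le>N. d \<eta> m * \<zeta> ^ m)"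
        by metis
      have "C k (x(l := \<zeta>)) = (\<Sum>m\<le>N. dft_coeff N k (\<lambda>\<eta>. d \<eta> m) * \<zeta> ^ m)"
        if "\<zeta> \<noteq> 0" for \<zeta>
        unfolding C_def dft_coeff_sum [symmetric]
      proof (rule dft_coeff_cong)
        fix \<eta> :: complex assume "\<eta> \<noteq> 0"
        show "q (x(l := \<zeta>, i := \<eta>)) = (\<Sum>m\<le>N. d \<eta> m * \<zeta> ^ m)"
          unfolding fun_upd_twist [OF \<open>l \<noteq> i\<close>] by (rule d [OF \<open>\<eta> \<noteq> 0\<close> that])
      qed
      then show ?thesis by (intro exI allI impI)
    qed
  qed
  then obtain c a where ca:
    "\<And>k x. k \<le> N \<Longrightarrow> (\<And>l. x l \<noteq> 0) \<Longrightarrow> C k x = c k * (\<Prod>l\<in>UNIV. x l ^ a k l)"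
    by metis
  define a' where "a' k = (a k)(i := a k i + k)" for k
  have shift: "(\<Prod>l\<in>UNIV. x l ^ a' k l) = (\<Prod>l\<in>UNIV. x l ^ a k l) * x i ^ k" for x :: "'n \<Rightarrow> complex" and k
  proof -
    have "(\<Prod>l\<in>UNIV - {i}. x l ^ a' k l) = (\<Prod>l\<in>UNIV - {i}. x l ^ a k l)"
      by (intro prod.cong) (auto simp: a'_def)
    then show ?thesis
      using prod.remove [of UNIV i "\<lambda>l. x l ^ a' k l"] prod.remove [of UNIV i "\<lambda>l. x l ^ a k l"]
      by (simp add: a'_def power_add)
  qed
  have q_sum: "q x = (\<Sum>k\<le>N. c k * (\<Prod>l\<in>UNIV. x l ^ a' k l))" if "\<And>l. x l \<noteq> 0" for x
    using expand [of x "x i"] that by (simp add: ca shift algebra_simps)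
  \<comment> \<open>Evaluate the eigenvalue equation at the point with all coordinates 1.\<close>
  have weight: "(\<Prod>l\<in>UNIV. \<mu> l ^ a' k l) = \<kappa>" if "k \<le> N" "c k \<noteq> 0" for k
    using C_eigen [of "\<lambda>_. 1" k] ca [of k \<mu>] ca [of k "\<lambda>_. 1"] that \<mu>0
    by (simp add: shift field_simps)
  show ?case
  proof (cases "\<exists>k\<le>N. c k \<noteq> 0")
    case False
    then show ?thesis using q_sum by (intro exI[of _ 0]) auto
  next
    case True
    then obtain k0 where k0: "k0 \<le> N" "c k0 \<noteq> 0" by blast
    have "c k * (\<Prod>l\<in>UNIV. x l ^ a' k l) = c k * (\<Prod>l\<in>UNIV. x l ^ a' k0 l)"
      if "k \<le> N" for k x
      using gen [of "a' k" "a' k0"] weight k0 that by (cases "c k = 0") auto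
    then have "(\<Sum>k\<le>N. c k * (\<Prod>l\<in>UNIV. x l ^ a' k l))
        = (\<Sum>k\<le>N. c k * (\<Prod>l\<in>UNIV. x l ^ a' k0 l))" for x
      by (intro sum.cong) auto
    then have "q x = (\<Sum>k\<le>N. c k) * (\<Prod>l\<in>UNIV. x l ^ a' k0 l)" if "\<And>l. x l \<noteq> 0" for x
      by (simp only: q_sum [OF that] sum_distrib_right)
    then show ?thesis by blast
  qed
qed

text \<open>
  Cancelling the common factor with exponents \<open>min (a i) (b i)\<close> turns a coincidence of two weights
  into a relation between powers of the \<open>\<mu> $ i\<close> with disjoint index sets.
\<close>
lemma generic_unique_exponent:
  fixes \<mu> :: "complex ^ 'n::{finite,linorder}" and a b :: "'n \<Rightarrow> nat"
  assumes "generic_hopf \<mu>" and "(\<Prod>i\<in>UNIV. \<mu> $ i ^ a i) = (\<Prod>i\<in>UNIV. \<mu> $ i ^ b i)"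
  shows "a = b"
proof -
  have \<mu>0: "\<mu> $ i \<noteq> 0" for i
    using assms(1) unfolding generic_hopf_def by (metis norm_zero less_irrefl)
  define A where "A = {i. b i \<le> a i}"
  define m where "m i = min (a i) (b i)" for i
  define r where "r i = (a i - b i) + (b i - a i)" for i
  have split: "(\<Prod>i\<in>UNIV. f i) = (\<Prod>i\<in>A. f i) * (\<Prod>i\<in>-A. f i)" for f :: "'n \<Rightarrow> complex"
    using prod.union_disjoint [of A "-A" f] by simp
  have "(\<Prod>i\<in>UNIV. \<mu> $ i ^ a i) = (\<Prod>i\<in>UNIV. \<mu> $ i ^ m i) * (\<Prod>i\<in>UNIV. \<mu> $ i ^ (a i - b i))"
    by (simp add: prod.distrib [symmetric] power_add [symmetric] m_def min_def)
       (rule prod.cong, auto)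
  moreover have "(\<Prod>i\<in>UNIV. \<mu> $ i ^ b i) = (\<Prod>i\<in>UNIV. \<mu> $ i ^ m i) * (\<Prod>i\<in>UNIV. \<mu> $ i ^ (b i - a i))"
    by (simp add: prod.distrib [symmetric] power_add [symmetric] m_def min_def)
       (rule prod.cong, auto)
  ultimately have "(\<Prod>i\<in>UNIV. \<mu> $ i ^ (a i - b i)) = (\<Prod>i\<in>UNIV. \<mu> $ i ^ (b i - a i))"
    using assms(2) \<mu>0 by simp
  moreover have "(\<Prod>i\<in>UNIV. \<mu> $ i ^ (a i - b i)) = (\<Prod>i\<in>A. \<mu> $ i ^ r i)"
    unfolding split by (simp add: A_def r_def)
  moreover have "(\<Prod>i\<in>UNIV. \<mu> $ i ^ (b i - a i)) = (\<Prod>i\<in>-A. \<mu> $ i ^ r i)"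
    unfolding split by (simp add: A_def r_def)
  ultimately have "(\<Prod>i\<in>A. \<mu> $ i ^ r i) = (\<Prod>i\<in>-A. \<mu> $ i ^ r i)"
    by simp
  then have "\<forall>i. r i = 0"
    using assms(1) unfolding generic_hopf_def by (metis Compl_disjoint Compl_partition)
  then show ?thesis
    by (intro ext) (simp add: r_def le_antisym)
qed

section \<open>Holomorphic eigenfunctions on the punctured space\<close>

lemma hopf_cover_iff: "z \<in> hopf_cover \<longleftrightarrow> (\<exists>i. z $ i \<noteq> 0)"
  by (auto simp: hopf_cover_def vec_eq_iff)

lemma norm_hopf_map_le:
  fixes z :: "complex ^ 'n"
  assumes "\<And>i. norm (\<mu> $ i) \<le> r"
  shows "norm (hopf_map \<mu> z) \<le> r * norm z"
proof -
  have r: "0 \<le> r" using assms norm_ge_zero order_trans by blast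
  have "norm (hopf_map \<mu> z) \<le> L2_set (\<lambda>i. r * norm (z $ i)) UNIV"
    unfolding norm_vec_def [of "hopf_map \<mu> z"]
    by (rule L2_set_mono) (auto simp: hopf_map_def norm_mult assms mult_right_mono)
  also have "\<dots> = r * norm z"
    using r by (simp add: norm_vec_def L2_set_right_distrib)
  finally show ?thesis .
qed

lemma norm_hopf_map_ge:
  fixes z :: "complex ^ 'n"
  assumes "0 \<le> s" and "\<And>i. s \<le> norm (\<mu> $ i)"
  shows "s * norm z \<le> norm (hopf_map \<mu> z)"
proof -
  have "s * norm z = L2_set (\<lambda>i. s * norm (z $ i)) UNIV"
    using assms by (simp add: norm_vec_def L2_set_right_distrib)
  also have "\<dots> \<le> norm (hopf_map \<mu> z)"
    unfolding norm_vec_def [of "hopf_map \<mu> z"]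
    by (rule L2_set_mono) (auto simp: hopf_map_def norm_mult assms mult_right_mono)
  finally show ?thesis .
qed

text \<open>
  Iterating the contraction brings a point \<open>z\<close> of large norm into a fixed shell after about
  \<open>log (norm z)\<close> steps, and each step changes \<open>h\<close> by the constant factor \<open>\<kappa>\<close>. So \<open>h\<close> grows
  at most like a power of the norm.
\<close>
lemma eigen_growth:
  fixes \<mu> :: "complex ^ 'n" and h :: "complex ^ 'n \<Rightarrow> complex"
  assumes \<mu>: "\<And>i. 0 < norm (\<mu> $ i) \<and> norm (\<mu> $ i) < 1"
    and cont: "continuous_on hopf_cover h"
    and eigen: "\<And>z. z \<in> hopf_cover \<Longrightarrow> h (hopf_map \<mu> z) = \<kappa> * h z"
    and "\<kappa> \<noteq> 0"
  obtains B N where "0 \<le> B" "\<And>z. 1 \<le> norm z \<Longrightarrow> norm (h z) \<le> B * norm z ^ N"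
proof -
  define r where "r = Max (range (\<lambda>i. norm (\<mu> $ i)))"
  define s where "s = Min (range (\<lambda>i. norm (\<mu> $ i)))"
  have r: "norm (\<mu> $ i) \<le> r" and s: "s \<le> norm (\<mu> $ i)" for i
    by (auto simp: r_def s_def)
  have "r \<in> range (\<lambda>i. norm (\<mu> $ i))" "s \<in> range (\<lambda>i. norm (\<mu> $ i))"
    unfolding r_def s_def by (rule Max_in Min_in; simp)+
  then have rs: "0 < r" "r < 1" "0 < s" using \<mu> by auto
  \<comment> \<open>With this exponent, dividing by \<kappa> costs no more than one contraction step gains in the N-th
    power of the norm.\<close>
  obtain N where N: "r ^ N < norm \<kappa>"
    using real_arch_pow_inv [of "norm \<kappa>" r] rs \<open>\<kappa> \<noteq> 0\<close> by auto
  \<comment> \<open>A shell so thick that the contraction cannot jump over it from outside.\<close>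
  define K where "K = cball (0 :: complex ^ 'n) (1 / s) - ball 0 1"
  have "compact K"
    unfolding K_def by (intro compact_diff) auto
  moreover have "K \<subseteq> hopf_cover"
    by (auto simp: K_def hopf_cover_def)
  ultimately have "bounded (h ` K)"
    using cont continuous_on_subset compact_continuous_image compact_imp_bounded by metis
  then obtain B where B: "0 < B" "\<And>z. z \<in> K \<Longrightarrow> norm (h z) \<le> B"
    by (auto simp: bounded_pos)
  have "norm (h z) \<le> B * norm z ^ N" if "1 \<le> norm z" "r ^ m * norm z \<le> 1" for m z
    using that
  proof (induction m arbitrary: z)
    case 0
    then have "z \<in> K" using rs s \<mu> by (auto simp: K_def field_simps intro: order.trans[OF s less_imp_le])
    then show ?case using B 0 by simp
  next
    case (Suc m)
    have grow: "B \<le> B * norm z ^ N"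
      using Suc.prems B by simp
    show ?case
    proof (cases "norm z \<le> 1 / s")
      case True
      then have "z \<in> K" using Suc.prems by (simp add: K_def)
      then show ?thesis using B(2) [of z] grow by linarith
    next
      case False
      have ge: "1 \<le> norm (hopf_map \<mu> z)"
        using norm_hopf_map_ge [of s \<mu> z] s rs False by (simp add: field_simps)
      have le: "norm (hopf_map \<mu> z) \<le> r * norm z"
        by (rule norm_hopf_map_le [OF r])
      have "r ^ m * norm (hopf_map \<mu> z) \<le> r ^ m * (r * norm z)"
        using le rs by (intro mult_left_mono) auto
      also have "\<dots> \<le> 1"
        using Suc.prems by (simp add: mult_ac)
      finally have "norm (h (hopf_map \<mu> z)) \<le> B * norm (hopf_map \<mu> z) ^ N"
        using Suc.IH ge by blast
      also have "\<dots> \<le> B * (r * norm z) ^ N"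
        using le B by (intro mult_left_mono power_mono) auto
      also have "\<dots> \<le> norm \<kappa> * (B * norm z ^ N)"
        using N B by (simp add: power_mult_distrib mult_ac mult_left_mono mult_right_mono)
      finally have "norm (h (hopf_map \<mu> z)) \<le> norm \<kappa> * (B * norm z ^ N)" .
      moreover have "z \<in> hopf_cover"
        using Suc.prems by (auto simp: hopf_cover_def)
      ultimately have "norm \<kappa> * norm (h z) \<le> norm \<kappa> * (B * norm z ^ N)"
        using eigen [of z] by (simp add: norm_mult)
      then show ?thesis
        using \<open>\<kappa> \<noteq> 0\<close> by simp
    qed
  qed
  moreover have "\<exists>m. r ^ m * norm z \<le> 1" if "1 \<le> norm z" for z :: "complex ^ 'n"
  proof -
    have "0 < 1 / norm z"
      using that by (intro divide_pos_pos) linarith+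
    then obtain m where "r ^ m < 1 / norm z"
      using real_arch_pow_inv [of "1 / norm z" r] rs by blast
    then have "r ^ m * norm z < 1"
      using that by (subst (asm) pos_less_divide_eq) linarith+
    then show ?thesis by (meson less_imp_le)
  qed
  ultimately show ?thesis
    using that [of B N] B by (meson less_imp_le)
qed

definition vec_upd :: "complex ^ 'n \<Rightarrow> 'n \<Rightarrow> complex \<Rightarrow> complex ^ 'n" where
  "vec_upd z i \<zeta> = (\<chi> l. if l = i then \<zeta> else z $ l)"

text \<open>
  Liouville's theorem for functions of polynomial growth, restricted to a coordinate line, on
  which the norm of a point is comparable with the absolute value of the moving coordinate.
\<close>
lemma polynomial_on_coordinate_lines:
  fixes h :: "complex ^ 'n \<Rightarrow> complex"
  assumes hol: "(\<lambda>\<zeta>. h (vec_upd z i \<zeta>)) holomorphic_on UNIV"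
    and bound: "0 \<le> B" "\<And>z. 1 \<le> norm z \<Longrightarrow> norm (h z) \<le> B * norm z ^ N"
  shows "\<exists>c. \<forall>\<zeta>. h (vec_upd z i \<zeta>) = (\<Sum>k\<le>N. c k * \<zeta> ^ k)"
proof -
  have "norm (h (vec_upd z i \<zeta>)) \<le> (B * 2 ^ N) * norm \<zeta> ^ N"
    if \<zeta>: "norm z + 1 \<le> norm \<zeta>" for \<zeta>
  proof -
    have "norm \<zeta> \<le> norm (vec_upd z i \<zeta>)"
      using Finite_Cartesian_Product.norm_nth_le [of "vec_upd z i \<zeta>" i] by (simp add: vec_upd_def)
    then have "1 \<le> norm (vec_upd z i \<zeta>)"
      using \<zeta> norm_ge_zero [of z] by linarith
    moreover have "norm (vec_upd z i \<zeta>) \<le> 2 * norm \<zeta>"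
    proof -
      have "norm (vec_upd z i \<zeta>) \<le> norm (vec_upd z i 0) + norm (axis i \<zeta> :: complex ^ 'n)"
        by (rule order_trans [OF eq_refl norm_triangle_ineq])
           (auto simp: vec_upd_def axis_def vec_eq_iff intro!: arg_cong [where f = norm])
      moreover have "norm (vec_upd z i 0) \<le> norm z"
        by (rule norm_le_componentwise_cart) (simp add: vec_upd_def)
      moreover have "norm (axis i \<zeta> :: complex ^ 'n) = norm \<zeta>"
        by (simp add: norm_vec_def L2_set_def axis_def if_distrib [of norm]
            if_distrib [of "\<lambda>x. x ^ 2"] cong: if_cong)
      ultimately show ?thesis using \<zeta> by linarith
    qed
    ultimately have "norm (h (vec_upd z i \<zeta>)) \<le> B * (2 * norm \<zeta>) ^ N"
      using bound order_trans [OF bound(2) mult_left_mono [OF power_mono]] by (metis norm_ge_zero)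
    then show ?thesis by (simp add: power_mult_distrib mult_ac)
  qed
  from Liouville_polynomial [OF hol this] show ?thesis
    by (intro exI allI)
qed

text \<open>
  The points with non-zero coordinates are dense, as every zero coordinate can be replaced
  by a small positive number.
\<close>
lemma continuous_eq_on_hopf_cover:
  fixes h p :: "complex ^ 'n \<Rightarrow> complex"
  assumes "continuous_on hopf_cover h" "continuous_on hopf_cover p"
    and torus: "\<And>z. (\<And>l. z $ l \<noteq> 0) \<Longrightarrow> h z = p z"
    and z: "z \<in> hopf_cover"
  shows "h z = p z"
proof -
  define y where "y m = (\<chi> l. if z $ l = 0 then of_real (inverse (real (Suc m))) else z $ l)" for m
  have y0: "y m $ l \<noteq> 0" for m l
  proof -
    have "complex_of_real (inverse (real (Suc m))) \<noteq> 0"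
      unfolding of_real_eq_0_iff by simp
    then show ?thesis
      unfolding y_def by simp
  qed
  then have yW: "y m \<in> hopf_cover" for m
    by (auto simp: hopf_cover_iff)
  have lim: "y \<longlonglongrightarrow> z"
  proof (rule vec_tendstoI)
    fix l
    have "(\<lambda>m. of_real (inverse (real (Suc m))) :: complex) \<longlonglongrightarrow> of_real 0"
      by (intro tendsto_of_real LIMSEQ_inverse_real_of_nat)
    then show "(\<lambda>m. y m $ l) \<longlonglongrightarrow> z $ l"
      by (cases "z $ l = 0") (simp_all add: y_def del: of_real_inverse of_nat_Suc)
  qed
  have "(\<lambda>m. h (y m)) \<longlonglongrightarrow> h z" "(\<lambda>m. p (y m)) \<longlonglongrightarrow> p z"
    by (rule continuous_on_tendsto_compose [OF _ lim z]; use assms yW in simp)+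
  then show ?thesis
    using torus [OF y0] LIMSEQ_unique by auto
qed

text \<open>
  A coordinate line through a point with non-zero coordinates misses the origin, because some other
  coordinate stays fixed and non-zero. So \<open>h\<close> is separately polynomial on the torus, with degrees bounded
  by the growth exponent, and the algebraic lemma applies there; continuity
  carries the formula to the coordinate hyperplanes.
\<close>
lemma eigenfunction_monomial:
  fixes \<mu> :: "complex ^ 'n::{finite,linorder}" and h :: "complex ^ 'n::{finite,linorder} \<Rightarrow> complex"
  assumes gen: "generic_hopf \<mu>" and card: "2 \<le> CARD('n)" and "\<kappa> \<noteq> 0"
    and cont: "continuous_on hopf_cover h"
    and hol: "\<And>i z. (\<And>\<zeta>. vec_upd z i \<zeta> \<in> hopf_cover) \<Longrightarrow> (\<lambda>\<zeta>. h (vec_upd z i \<zeta>)) holomorphic_on UNIV"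
    and eigen: "\<And>z. z \<in> hopf_cover \<Longrightarrow> h (hopf_map \<mu> z) = \<kappa> * h z"
  shows "\<exists>c a. \<forall>z\<in>hopf_cover. h z = c * (\<Prod>i\<in>UNIV. z $ i ^ a i)"
proof -
  have \<mu>: "0 < norm (\<mu> $ i) \<and> norm (\<mu> $ i) < 1" for i
    using gen by (simp add: generic_hopf_def)
  obtain B N where B: "0 \<le> B" "\<And>z. 1 \<le> norm z \<Longrightarrow> norm (h z) \<le> B * norm z ^ N"
    using eigen_growth [OF \<mu> cont eigen \<open>\<kappa> \<noteq> 0\<close>] by blast
  have "\<exists>c a. \<forall>x. (\<forall>l. x l \<noteq> 0) \<longrightarrow> h (\<chi> i. x i) = c * (\<Prod>i\<in>UNIV. x i ^ a i)"
  proof (rule separately_polynomial_eigenfunction_monomial [where S = UNIV and \<mu> = "\<lambda>i. \<mu> $ i" and \<kappa> = \<kappa> and N = N])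
    show "\<mu> $ i \<noteq> 0" for i using \<mu> [of i] by auto
    show "a = b" if "(\<Prod>i\<in>UNIV. \<mu> $ i ^ a i) = (\<Prod>i\<in>UNIV. \<mu> $ i ^ b i)" for a b
      using generic_unique_exponent [OF gen that] .
    show "h (\<chi> i. x i) = h (\<chi> i. y i)" if "\<And>i. i \<in> UNIV \<Longrightarrow> x i = y i" for x y
      using that by simp
    show "h (\<chi> i. \<mu> $ i * x i) = \<kappa> * h (\<chi> i. x i)" if "\<And>l. x l \<noteq> 0" for x
      using eigen [of "\<chi> i. x i"] that by (simp add: hopf_cover_iff hopf_map_def)
    show "\<exists>c. \<forall>\<zeta>. \<zeta> \<noteq> 0 \<longrightarrow> h (\<chi> l. (x(i := \<zeta>)) l) = (\<Sum>k\<le>N. c k * \<zeta> ^ k)"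
      if x: "\<And>l. x l \<noteq> 0" for i x
    proof -
      have "\<exists>l. l \<noteq> i"
      proof (rule ccontr)
        assume "\<not> ?thesis"
        then have "(UNIV :: 'n set) = {i}" by auto
        then have "CARD('n) = card {i}" by (rule arg_cong)
        then show False using card by simp
      qed
      then have "vec_upd (\<chi> i. x i) i \<zeta> \<in> hopf_cover" for \<zeta>
        using x by (auto simp: hopf_cover_iff vec_upd_def)
      then have "\<exists>c. \<forall>\<zeta>. h (vec_upd (\<chi> i. x i) i \<zeta>) = (\<Sum>k\<le>N. c k * \<zeta> ^ k)"
        by (intro polynomial_on_coordinate_lines [OF hol B])
      then show ?thesis
        by (auto simp: vec_upd_def fun_upd_def vec_lambda_beta cong: if_cong)
    qed
  qed simp
  then obtain c a where ca: "\<And>x. (\<forall>l. x l \<noteq> 0) \<Longrightarrow> h (\<chi> i. x i) = c * (\<Prod>i\<in>UNIV. x i ^ a i)"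
    by blast
  have "h z = c * (\<Prod>i\<in>UNIV. z $ i ^ a i)" if "z \<in> hopf_cover" for z
  proof (rule continuous_eq_on_hopf_cover [OF cont _ _ that])
    show "continuous_on hopf_cover (\<lambda>z. c * (\<Prod>i\<in>UNIV. z $ i ^ a i))"
      by (intro continuous_intros)
    show "h z = c * (\<Prod>i\<in>UNIV. z $ i ^ a i)" if "\<And>l. z $ l \<noteq> 0" for z
      using ca [of "\<lambda>i. z $ i"] that by (simp add: vec_nth_inverse)
  qed
  then show ?thesis by blast
qed

section \<open>Pulling a bundle morphism back to the cover\<close>

text \<open>
  The element \<open>m\<close> of the deck group, which is infinite cyclic; \<open>orbit_rel\<close> speaks of natural powers
  in both directions, and integer exponents merge the two cases.
\<close>
definition hopf_power :: "complex ^ 'n \<Rightarrow> int \<Rightarrow> complex ^ 'n \<Rightarrow> complex ^ 'n" where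
  "hopf_power \<mu> m z = (\<chi> i. \<mu> $ i powi m * z $ i)"

lemma hopf_power_0 [simp]: "hopf_power \<mu> 0 z = z"
  by (simp add: hopf_power_def vec_eq_iff)

lemma hopf_power_1 [simp]: "hopf_power \<mu> 1 = hopf_map \<mu>"
  by (simp add: hopf_power_def hopf_map_def fun_eq_iff vec_eq_iff)

lemma hopf_power_add:
  assumes "\<And>i. \<mu> $ i \<noteq> 0"
  shows "hopf_power \<mu> (m + k) z = hopf_power \<mu> m (hopf_power \<mu> k z)"
  using assms by (simp add: hopf_power_def vec_eq_iff power_int_add mult_ac)

lemma linear_hopf_power: "linear (hopf_power \<mu> m)"
  by (rule linearI) (simp_all add: hopf_power_def vec_eq_iff algebra_simps)

lemma hopf_power_scale: "hopf_power \<mu> m (c *s z) = c *s hopf_power \<mu> m z"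
  by (simp add: hopf_power_def vec_eq_iff)

lemma tangent_act_power:
  "(tangent_act \<mu> ^^ m) (z, w) = (hopf_power \<mu> (int m) z, hopf_power \<mu> (int m) w)"
  by (induction m)
     (simp_all add: tangent_act_def frechet_derivative_hopf_map hopf_power_def hopf_map_def
        vec_eq_iff del: of_nat_Suc)

lemma tangent_orbit_iff:
  assumes "\<And>i. \<mu> $ i \<noteq> 0"
  shows "((z, w), (z', w')) \<in> orbit_rel (tangent_act \<mu>) \<longleftrightarrow>
    (\<exists>m. z' = hopf_power \<mu> m z \<and> w' = hopf_power \<mu> m w)"
proof
  have inv: "hopf_power \<mu> (- m) (hopf_power \<mu> m u) = u" for m u
    using hopf_power_add [OF assms, of "- m" m u] by simp
  show "\<exists>m. z' = hopf_power \<mu> m z \<and> w' = hopf_power \<mu> m w"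
    if "((z, w), (z', w')) \<in> orbit_rel (tangent_act \<mu>)"
  proof -
    from that obtain m where
      "(z' = hopf_power \<mu> (int m) z \<and> w' = hopf_power \<mu> (int m) w) \<or>
       (z = hopf_power \<mu> (int m) z' \<and> w = hopf_power \<mu> (int m) w')"
      by (auto simp: orbit_rel_def tangent_act_power)
    then show ?thesis
      using inv by metis
  qed
  show "((z, w), (z', w')) \<in> orbit_rel (tangent_act \<mu>)"
    if "\<exists>m. z' = hopf_power \<mu> m z \<and> w' = hopf_power \<mu> m w"
  proof -
    from that obtain m where m: "z' = hopf_power \<mu> m z" "w' = hopf_power \<mu> m w"
      by blast
    show ?thesis
    proof (cases m)
      case (nonneg n)
      then show ?thesis
        using m by (auto simp: orbit_rel_def tangent_act_power)
    next
      case (neg n)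
      then have "z = hopf_power \<mu> (int (Suc n)) z'" "w = hopf_power \<mu> (int (Suc n)) w'"
        using m inv [of m] by (metis minus_minus)+
      then show ?thesis
        unfolding orbit_rel_def by (auto simp: tangent_act_power intro!: exI [of _ "Suc n"] simp del: of_nat_Suc)
    qed
  qed
qed

lemma tangent_class_eq_iff:
  assumes "\<And>i. \<mu> $ i \<noteq> 0"
  shows "tangent_class \<mu> z w = tangent_class \<mu> z' w' \<longleftrightarrow>
    (\<exists>m. z' = hopf_power \<mu> m z \<and> w' = hopf_power \<mu> m w)"
proof -
  have "inj (hopf_map \<mu>)"
    using assms by (auto simp: inj_def hopf_map_def vec_eq_iff)
  then have "inj (tangent_act \<mu>)"
    by (auto simp: inj_def tangent_act_def frechet_derivative_hopf_map)
  from eq_equiv_class_iff [OF equiv_orbit_rel [OF this]] show ?thesis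
    by (simp add: tangent_orbit_iff [OF assms])
qed

lemma hopf_power_fixed_point:
  assumes "\<And>i. 0 < norm (\<mu> $ i) \<and> norm (\<mu> $ i) < 1"
    and "z \<in> hopf_cover" and "hopf_power \<mu> m z = z"
  shows "m = 0"
proof -
  obtain i where i: "z $ i \<noteq> 0"
    using assms(2) by (auto simp: hopf_cover_iff)
  have "\<mu> $ i powi m * z $ i = z $ i"
    using arg_cong [OF assms(3), of "\<lambda>u. u $ i"] by (simp add: hopf_power_def)
  then have "norm (\<mu> $ i) powi m = norm (\<mu> $ i) powi 0"
    using i by (simp add: norm_power_int [symmetric])
  then show ?thesis
    using power_int_strict_decreasing [of m 0 "norm (\<mu> $ i)"]
      power_int_strict_decreasing [of 0 m "norm (\<mu> $ i)"] assms(1) [of i]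
    by (cases m "0 :: int" rule: linorder_cases) auto
qed

text \<open>
  The deck group acts freely, so a tangent vector of the quotient has only one representative
  over a given point of the cover.
\<close>
lemma tangent_class_fibre_inj:
  assumes "\<And>i. 0 < norm (\<mu> $ i) \<and> norm (\<mu> $ i) < 1"
    and "z \<in> hopf_cover" and "tangent_class \<mu> z w = tangent_class \<mu> z w'"
  shows "w = w'"
proof -
  have "\<mu> $ i \<noteq> 0" for i using assms(1) [of i] by auto
  then obtain m where m: "z = hopf_power \<mu> m z" "w' = hopf_power \<mu> m w"
    using assms(3) tangent_class_eq_iff by metis
  then have "m = 0"
    using hopf_power_fixed_point [OF assms(1,2)] by simp
  then show ?thesis using m by simp
qed

lemma line_class_hopf_map:
  assumes "\<And>i. \<mu> $ i \<noteq> 0" and "b \<noteq> 0"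
  shows "line_class \<mu> b (hopf_map \<mu> z) (b * t) = line_class \<mu> b z t"
proof -
  have "inj (hopf_map \<mu>)"
    using assms by (auto simp: inj_def hopf_map_def vec_eq_iff)
  then have "inj (line_act \<mu> b)"
    using assms by (auto simp: inj_def line_act_def)
  moreover have "((z, t), (hopf_map \<mu> z, b * t)) \<in> orbit_rel (line_act \<mu> b)"
    unfolding orbit_rel_def by (auto simp: line_act_def intro!: exI [of _ "1 :: nat"])
  ultimately show ?thesis
    using equiv_class_eq [OF equiv_orbit_rel] by metis
qed

text \<open>
  A fibrewise linear map on a line is determined by its value at 1, and that value is the vector field.
\<close>
lemma bundle_morphism_lift:
  assumes "bundle_morphism \<mu> b F"
  obtains g where "induced_by \<mu> b F g"
proof -
  have "\<exists>w. \<forall>t. F (line_class \<mu> b z t) = tangent_class \<mu> z (t *s w)" if "z \<in> hopf_cover" for z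
  proof -
    have "orbit_rel (hopf_map \<mu>) `` {z} \<in> hopf_manifold \<mu>"
      using that by (auto simp: hopf_manifold_def quotientI)
    moreover have "z \<in> orbit_rel (hopf_map \<mu>) `` {z}"
      by (auto simp: orbit_rel_def intro: exI [of _ 0])
    ultimately obtain l where l: "Vector_Spaces.linear (*) (*s) l"
      "\<And>t. F (line_class \<mu> b z t) = tangent_class \<mu> z (l t)"
      using assms unfolding bundle_morphism_def by blast
    have "l t = t *s l 1" for t
      using module_hom.scale [OF Vector_Spaces.linear.axioms(3) [OF l(1)], of t 1] by simp
    then show ?thesis using l(2) by metis
  qed
  then obtain g where "\<And>z t. z \<in> hopf_cover \<Longrightarrow> F (line_class \<mu> b z t) = tangent_class \<mu> z (t *s g z)"
    by metis
  then show ?thesis using that by (auto simp: induced_by_def)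
qed

lemma hopf_map_in_cover:
  assumes "\<And>i. \<mu> $ i \<noteq> 0" "z \<in> hopf_cover"
  shows "hopf_map \<mu> z \<in> hopf_cover"
  using assms by (auto simp: hopf_cover_iff hopf_map_def)

text \<open>
  The points \<open>(z, 1)\<close> and \<open>(hopf_map \<mu> z, b)\<close> represent the same element of the line bundle, and
  the deck transformation acts on tangent vectors by its own linear formula.
\<close>
lemma induced_by_equivariant:
  assumes \<mu>: "\<And>i. 0 < norm (\<mu> $ i) \<and> norm (\<mu> $ i) < 1" and "b \<noteq> 0"
    and g: "induced_by \<mu> b F g" and z: "z \<in> hopf_cover"
  shows "b *s g (hopf_map \<mu> z) = hopf_map \<mu> (g z)"
proof -
  have \<mu>0: "\<mu> $ i \<noteq> 0" for i using \<mu> [of i] by auto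
  have "tangent_class \<mu> (hopf_map \<mu> z) (b *s g (hopf_map \<mu> z)) = F (line_class \<mu> b (hopf_map \<mu> z) (b * 1))"
    using g hopf_map_in_cover [OF \<mu>0 z] by (simp add: induced_by_def)
  also have "\<dots> = F (line_class \<mu> b z 1)"
    by (simp only: line_class_hopf_map [OF \<mu>0 \<open>b \<noteq> 0\<close>])
  also have "\<dots> = tangent_class \<mu> z (g z)"
    using g z by (simp add: induced_by_def)
  also have "\<dots> = tangent_class \<mu> (hopf_map \<mu> z) (hopf_map \<mu> (g z))"
    unfolding tangent_class_eq_iff [OF \<mu>0] by (intro exI [of _ 1]) simp
  finally show ?thesis
    by (rule tangent_class_fibre_inj [OF \<mu> hopf_map_in_cover [OF \<mu>0 z]])
qed

text \<open>
  Near a point \<open>z0\<close> the map has a holomorphic lift \<open>H\<close>, but at \<open>z\<close> this lift may differ from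
  \<open>(z, g z)\<close> by a deck transformation with exponent \<open>m z\<close>. Taking logarithms in a coordinate that is non-zero at
  \<open>z0\<close> expresses \<open>m\<close> as a continuous function; being integer valued it is locally
  constant, so near \<open>z0\<close> the field \<open>g\<close> is the vector part of \<open>H\<close> followed by one fixed linear map.
\<close>
lemma induced_by_holomorphic:
  fixes \<mu> :: "complex ^ 'n"
  assumes \<mu>: "\<And>i. 0 < norm (\<mu> $ i) \<and> norm (\<mu> $ i) < 1"
    and hol: "holomorphic_bundle_map \<mu> b F" and g: "induced_by \<mu> b F g"
  shows "holo_wrt ((*s) \<i>) ((*s) \<i>) g hopf_cover"
  unfolding holo_wrt_def
proof
  fix z0 :: "complex ^ 'n" assume z0: "z0 \<in> hopf_cover"
  have \<mu>0: "\<mu> $ i \<noteq> 0" for i using \<mu> [of i] by auto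
  have inv: "hopf_power \<mu> (- m) (hopf_power \<mu> m u) = u" for m u
    using hopf_power_add [OF \<mu>0, of "- m" m u] by simp
  obtain U G where U: "open U" "(z0, 1) \<in> U" "U \<subseteq> hopf_cover \<times> UNIV"
    and G: "holo_wrt (map_prod ((*s) \<i>) ((*) \<i>)) (map_prod ((*s) \<i>) ((*s) \<i>)) G U"
    and FG: "\<And>q. q \<in> U \<Longrightarrow> F (orbit_rel (line_act \<mu> b) `` {q}) = orbit_rel (tangent_act \<mu>) `` {G q}"
  proof -
    have "(z0, 1) \<in> hopf_cover \<times> (UNIV :: complex set)" using z0 by simp
    from bspec [OF hol [unfolded holomorphic_bundle_map_def] this] show ?thesis
      using that by (elim exE conjE) simp
  qed
  obtain D where D: "(G has_derivative D) (at (z0, 1))"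
    and D_i: "\<And>w. D (map_prod ((*s) \<i>) ((*) \<i>) w) = map_prod ((*s) \<i>) ((*s) \<i>) (D w)"
    using G U(2) unfolding holo_wrt_def by blast
  define H where "H z = G (z, 1)" for z
  have H_deriv: "(H has_derivative (\<lambda>w. D (w, 0))) (at z0)"
  proof -
    have "((\<lambda>z. (z, 1 :: complex)) has_derivative (\<lambda>w. (w, 0))) (at z0)"
      by (auto intro!: derivative_eq_intros)
    from diff_chain_at [OF this D] show ?thesis
      by (simp add: H_def [abs_def] o_def)
  qed
  have near: "\<forall>\<^sub>F z in nhds z0. (z, 1) \<in> U"
  proof -
    have "open ((\<lambda>z. (z, 1 :: complex)) -` U)"
      using U(1) by (intro open_vimage continuous_intros)
    then show ?thesis
      using eventually_nhds_in_open [of _ z0] U(2) by force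
  qed
  have deck: "\<exists>m. fst (H z) = hopf_power \<mu> m z \<and> snd (H z) = hopf_power \<mu> m (g z)"
    if "(z, 1) \<in> U" for z
  proof -
    have "z \<in> hopf_cover" using that U(3) by auto
    then have "tangent_class \<mu> z (g z) = tangent_class \<mu> (fst (H z)) (snd (H z))"
      using g FG [OF that] by (simp add: induced_by_def H_def)
    then show ?thesis
      by (simp only: tangent_class_eq_iff [OF \<mu>0])
  qed
  then obtain m where m: "\<And>z. (z, 1) \<in> U \<Longrightarrow> fst (H z) = hopf_power \<mu> (m z) z"
    "\<And>z. (z, 1) \<in> U \<Longrightarrow> snd (H z) = hopf_power \<mu> (m z) (g z)"
    by metis
  obtain i where i: "z0 $ i \<noteq> 0"
    using z0 by (auto simp: hopf_cover_iff)
  \<comment> \<open>Continuous at z0, and equal to the exponent m by the next step.\<close>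
  define \<phi> where "\<phi> z = ln (norm (fst (H z) $ i) / norm (z $ i)) / ln (norm (\<mu> $ i))" for z
  have \<phi>: "\<phi> z = of_int (m z)" if "(z, 1) \<in> U" "z $ i \<noteq> 0" for z
  proof -
    have "norm (fst (H z) $ i) / norm (z $ i) = norm (\<mu> $ i) powi m z"
      using that m(1) by (simp add: hopf_power_def norm_mult norm_power_int)
    moreover have "ln (norm (\<mu> $ i)) < 0"
      using \<mu> [of i] by simp
    ultimately show ?thesis
      using \<mu> [of i] by (simp add: \<phi>_def powr_real_of_int' [symmetric] ln_powr)
  qed
  have nz: "\<forall>\<^sub>F z in nhds z0. z $ i \<noteq> 0"
    by (rule tendsto_imp_eventually_ne [OF tendsto_vec_nth [OF filterlim_ident]]) (use i in auto)
  have "isCont \<phi> z0"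
  proof -
    have "isCont H z0"
      using H_deriv by (rule has_derivative_continuous)
    moreover have "norm (fst (H z0) $ i) \<noteq> 0"
      using m(1) [OF U(2)] i \<mu>0 by (simp add: hopf_power_def)
    ultimately show ?thesis
      unfolding \<phi>_def using i \<mu> [of i] by (intro continuous_intros) auto
  qed
  then have "\<forall>\<^sub>F z in nhds z0. dist (\<phi> z) (\<phi> z0) < 1"
    unfolding eventually_nhds_conv_at by (auto simp: isCont_def intro: tendstoD)
  then have ev: "\<forall>\<^sub>F z in nhds z0. hopf_power \<mu> (- m z0) (snd (H z)) = g z"
    using near nz
  proof eventually_elim
    case (elim z)
    then have "\<bar>real_of_int (m z) - real_of_int (m z0)\<bar> < 1"
      using \<phi> [of z] \<phi> [OF U(2) i] by (simp add: dist_real_def)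
    then have "m z = m z0" by linarith
    then show ?case using m(2) [of z] elim inv by simp
  qed
  define D' where "D' w = hopf_power \<mu> (- m z0) (snd (D (w, 0)))" for w
  have "bounded_linear (hopf_power \<mu> (- m z0))"
    using linear_hopf_power by (rule linear_conv_bounded_linear [THEN iffD1])
  then have "((\<lambda>z. hopf_power \<mu> (- m z0) (snd (H z))) has_derivative D') (at z0)"
    unfolding D'_def by (intro bounded_linear.has_derivative [of "hopf_power \<mu> (- m z0)"] has_derivative_snd H_deriv)
  then have "(g has_derivative D') (at z0)"
    using ev has_derivative_transform_eventually [OF _ _ _ UNIV_I]
    unfolding eventually_nhds_conv_at by blast
  moreover have "D' (\<i> *s w) = \<i> *s D' w" for w
    using D_i [of "(w, 0)"] by (cases "D (w, 0)") (simp add: D'_def hopf_power_scale)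
  ultimately show "\<exists>D. (g has_derivative D) (at z0) \<and> (\<forall>w. D (\<i> *s w) = \<i> *s D w)"
    by blast
qed

text \<open>
  A real derivative that commutes with multiplication by \<open>\<i>\<close> is complex linear, so along
  a complex coordinate line it is a complex derivative.
\<close>
lemma holo_wrt_component_on_line:
  fixes g :: "complex ^ 'n \<Rightarrow> complex ^ 'n"
  assumes hol: "holo_wrt ((*s) \<i>) ((*s) \<i>) g hopf_cover"
    and line: "\<And>\<zeta>. vec_upd z i \<zeta> \<in> hopf_cover"
  shows "(\<lambda>\<zeta>. g (vec_upd z i \<zeta>) $ k) holomorphic_on UNIV"
proof (rule holomorphic_onI)
  fix \<zeta>
  obtain D where D: "(g has_derivative D) (at (vec_upd z i \<zeta>))"
    and D_i: "\<And>w. D (\<i> *s w) = \<i> *s D w"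
    using hol line unfolding holo_wrt_def by blast
  define E where "E s = D (axis i s) $ k" for s
  have "linear (\<lambda>s. axis i s :: complex ^ 'n)"
    by (rule linearI) (simp_all add: axis_def vec_eq_iff)
  then have ax: "bounded_linear (\<lambda>s. axis i s :: complex ^ 'n)"
    by (simp add: linear_conv_bounded_linear)
  define z' where "z' = vec_upd z i 0"
  have "vec_upd z i = (\<lambda>\<zeta>. z' + axis i \<zeta>)"
    by (auto simp: z'_def vec_upd_def axis_def vec_eq_iff)
  then have "(vec_upd z i has_derivative (\<lambda>s. axis i s)) (at \<zeta>)"
    using has_derivative_add [OF has_derivative_const bounded_linear_imp_has_derivative [OF ax]]
    by simp
  from diff_chain_at [OF this D]
  have der: "((\<lambda>\<zeta>. g (vec_upd z i \<zeta>) $ k) has_derivative E) (at \<zeta>)"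
    using bounded_linear.has_derivative [OF bounded_linear_vec_nth]
    by (simp add: E_def [abs_def] o_def)
  have E_lin: "linear E"
    using der has_derivative_linear by blast
  have E_i: "E (\<i> * s) = \<i> * E s" for s
  proof -
    have "axis i (\<i> * s) = \<i> *s (axis i s :: complex ^ 'n)"
      by (simp add: axis_def vec_eq_iff)
    then show ?thesis by (simp add: E_def D_i)
  qed
  have "E s = E 1 * s" for s
  proof -
    have "E s = E (Re s *\<^sub>R 1 + Im s *\<^sub>R (\<i> * 1))"
      by (rule arg_cong [where f = E]) (simp add: complex_eq_iff)
    also have "\<dots> = Re s *\<^sub>R E 1 + Im s *\<^sub>R (\<i> * E 1)"
      using E_lin by (simp only: linear_add linear_scale E_i)
    also have "\<dots> = E 1 * s"
      by (simp add: complex_eq_iff)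
    finally show ?thesis .
  qed
  then have "E = (*) (E 1)" by (rule ext)
  then have "((\<lambda>\<zeta>. g (vec_upd z i \<zeta>) $ k) has_field_derivative E 1) (at \<zeta>)"
    using der by (simp only: has_field_derivative_def)
  then show "(\<lambda>\<zeta>. g (vec_upd z i \<zeta>) $ k) field_differentiable at \<zeta> within UNIV"
    by (auto simp: field_differentiable_def)
qed

section \<open>Foliations on generic Hopf manifolds\<close>

theorem theorem1p3:
  fixes \<mu> :: "complex ^ 'n::{finite,linorder}"
    and b :: complex
    and F :: "((complex ^ 'n::{finite,linorder}) \<times> complex) set \<Rightarrow>
      ((complex ^ 'n::{finite,linorder}) \<times> (complex ^ 'n::{finite,linorder})) set"
  assumes "CARD('n) \<ge> 3"
    and "generic_hopf \<mu>"
    and "b \<noteq> 0"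
    and "foliation \<mu> b F"
  shows "\<exists>v. monomial_vector_field v \<and> induced_by \<mu> b F v"
proof -
  have \<mu>: "0 < norm (\<mu> $ i) \<and> norm (\<mu> $ i) < 1" for i
    using assms(2) by (simp add: generic_hopf_def)
  have morph: "bundle_morphism \<mu> b F"
    using assms(4) by (simp add: foliation_def)
  obtain g where g: "induced_by \<mu> b F g"
    using bundle_morphism_lift [OF morph] .
  have hol: "holo_wrt ((*s) \<i>) ((*s) \<i>) g hopf_cover"
    using morph by (intro induced_by_holomorphic [OF \<mu> _ g]) (simp add: bundle_morphism_def)
  have "\<exists>c a. \<forall>z\<in>hopf_cover. g z $ k = c * (\<Prod>i\<in>UNIV. z $ i ^ a i)" for k
  proof (rule eigenfunction_monomial [OF assms(2)])
    show "2 \<le> CARD('n)" using assms(1) by simp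
    show "\<mu> $ k / b \<noteq> 0" using \<mu> [of k] assms(3) by auto
    show "continuous_on hopf_cover (\<lambda>z. g z $ k)"
    proof (intro continuous_on_component continuous_at_imp_continuous_on ballI)
      show "isCont g z" if "z \<in> hopf_cover" for z
        using hol that has_derivative_continuous unfolding holo_wrt_def by blast
    qed
    show "(\<lambda>\<zeta>. g (vec_upd z i \<zeta>) $ k) holomorphic_on UNIV"
      if "\<And>\<zeta>. vec_upd z i \<zeta> \<in> hopf_cover" for i z
      by (rule holo_wrt_component_on_line [OF hol that])
    show "g (hopf_map \<mu> z) $ k = \<mu> $ k / b * g z $ k" if "z \<in> hopf_cover" for z
      using arg_cong [OF induced_by_equivariant [OF \<mu> assms(3) g that], of "\<lambda>w. w $ k"] assms(3)
      by (simp add: hopf_map_def field_simps)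
  qed
  then have "monomial_vector_field g"
    by (simp add: monomial_vector_field_def)
  then show ?thesis using g by blast
qed

end
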